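(* For every positive integer $n$, $$\sum_{\substack{d\mid n\\ d\equiv 1 \ (\mathrm{mod}\ 2)}}\frac{1}{d}=\frac{1}{2}\sum_{r=1}^{n}\frac{(-1)^{n+r}}{r}\binom{n}{r}\,c_{r}(n),$$ where the left-hand sum is over the odd positive divisors $d$ of $n$, and $c_r(n)$ is the number of representations of $n$ as a sum of $r$ squares.
   Context: For a positive integer $r$ and an integer $n\ge 0$, $c_r(n)$ is the number of representations of $n$ as a sum of $r$ squares of integers, where representations with different orders and different signs are counted as distinct; that is, $c_r(n)=\#\{(x_1,\dots,x_r)\in\mathbb{Z}^r : x_1^2+\cdots+x_r^2=n\}$. Equivalently, $\theta(q)^r=\sum_{n=0}^{\infty}c_r(n)(-1)^n q^n$ for $|q|<1$, where $\theta(q)=\prod_{j=1}^{\infty}\frac{1-q^j}{1+q^j}=\sum_{n=-\infty}^{\infty}(-1)^n q^{n^2}$. *)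

theory Defs
  imports Complex_Main
begin

definition num_reps_squares :: "nat \<Rightarrow> nat \<Rightarrow> nat" where
  "num_reps_squares r n =
     card {xs :: int list. length xs = r \<and> (\<Sum>x\<leftarrow>xs. x\<^sup>2) = int n}"

lemma finite_reps_squares:
  "finite {xs :: int list. length xs = r \<and> (\<Sum>x\<leftarrow>xs. x\<^sup>2) = int n}"
proof (rule finite_subset)
  have le: "y\<^sup>2 \<le> (\<Sum>x\<leftarrow>xs. x\<^sup>2)" if "y \<in> set xs" for y :: int and xs
    using that by (intro member_le_sum_list) auto
  have bound: "y \<in> {- int n..int n}" if "y\<^sup>2 \<le> int n" for y :: int
  proof -
    have "\<bar>y\<bar> \<le> y\<^sup>2"
      using self_le_power[of "\<bar>y\<bar>" 2] by (cases "y = 0") auto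
    with that show ?thesis by auto
  qed
  show "{xs :: int list. length xs = r \<and> (\<Sum>x\<leftarrow>xs. x\<^sup>2) = int n}
          \<subseteq> {xs. set xs \<subseteq> {- int n..int n} \<and> length xs = r}"
    using le bound by fastforce
  show "finite {xs. set xs \<subseteq> {- int n..int n} \<and> length xs = r}"
    by (rule finite_lists_length_eq) simp
qed

end

theory Submission
  imports Defs "HOL-Computational_Algebra.Formal_Power_Series"
begin

text \<open>
  Write \<open>\<theta> = \<Sum>(-1)\<^sup>k q\<^bsup>k\<^sup>2\<^esup>\<close> and \<open>P\<^sub>n = \<Prod>\<^bsub>j\<le>n\<^esub> (1 - q\<^sup>j) / (1 + q\<^sup>j)\<close>. A Shanks-type finite identity
  expresses the partial sum of \<open>\<theta>\<close> up to \<open>|k| \<le> n\<close> as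
  \<open>P\<^sub>n \<Sum>\<^bsub>s\<le>n\<^esub> (-1)\<^sup>s (-1;q)\<^sub>s / (q;q)\<^sub>s q\<^bsup>s(n+1)\<^esup>\<close>, so \<open>\<theta> \<equiv> P\<^sub>n\<close> modulo \<open>q\<^bsup>n+1\<^esup>\<close>. The
  \<open>n\<close>-th coefficient of \<open>log \<theta>\<close> is then computed twice: from the logarithmic derivative
  \<open>q P\<^sub>n' / P\<^sub>n = -2 \<Sum>\<^bsub>j\<le>n\<^esub> j q\<^sup>j / (1 - q\<^bsup>2j\<^esup>)\<close>, which produces the divisor sum, and from
  \<open>\<Sum>\<^bsub>m\<le>n\<^esub> (-1)\<^bsup>m+1\<^esup> (\<theta> - 1)\<^sup>m / m\<close>, expanded in powers of \<open>\<theta>\<close>.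
\<close>

unbundle fps_syntax

section \<open>Gauss's product for the theta series\<close>

fun gauss_prod :: "nat \<Rightarrow> real fps" where
  "gauss_prod 0 = 1"
| "gauss_prod (Suc n) = gauss_prod n * (1 - fps_X ^ Suc n) * inverse (1 + fps_X ^ Suc n)"

text \<open>\<open>gauss_coeff s\<close> is \<open>(-1)\<^sup>s (-1;q)\<^sub>s / (q;q)\<^sub>s\<close>.\<close>

fun gauss_coeff :: "nat \<Rightarrow> real fps" where
  "gauss_coeff 0 = 1"
| "gauss_coeff (Suc s) = - gauss_coeff s * (1 + fps_X ^ s) * inverse (1 - fps_X ^ Suc s)"

lemma gauss_prod_Suc_mult:
  "gauss_prod (Suc n) * (1 + fps_X ^ Suc n) = gauss_prod n * (1 - fps_X ^ Suc n)"
proof -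
  have "inverse (1 + fps_X ^ Suc n) * (1 + fps_X ^ Suc n) = (1 :: real fps)"
    by (rule inverse_mult_eq_1) simp
  then show ?thesis by (simp add: mult.assoc del: power_Suc)
qed

lemma gauss_coeff_Suc_mult:
  "gauss_coeff (Suc s) * (1 - fps_X ^ Suc s) = - gauss_coeff s * (1 + fps_X ^ s)"
proof -
  have "inverse (1 - fps_X ^ Suc s) * (1 - fps_X ^ Suc s) = (1 :: real fps)"
    by (rule inverse_mult_eq_1) simp
  then show ?thesis by (simp add: mult.assoc del: power_Suc)
qed

text \<open>Passing from \<open>n\<close> to \<open>Suc n\<close>, the factor
  \<open>1 + fps_X ^ Suc n\<close> gained by the coefficient cancels against the denominator gained
  by the product, so only the sign changes. The 2 is \<open>1 + fps_X ^ 0\<close>.\<close>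

lemma gauss_coeff_mult_gauss_prod:
  "gauss_coeff (Suc n) * (1 - fps_X ^ Suc n) * gauss_prod n = 2 * (-1) ^ Suc n"
proof (induction n)
  case 0
  show ?case using gauss_coeff_Suc_mult[of 0] by simp
next
  case (Suc n)
  have "gauss_coeff (Suc (Suc n)) * (1 - fps_X ^ Suc (Suc n)) * gauss_prod (Suc n)
      = - gauss_coeff (Suc n) * (gauss_prod (Suc n) * (1 + fps_X ^ Suc n))"
    unfolding gauss_coeff_Suc_mult by (simp only: mult_ac)
  also have "\<dots> = - (gauss_coeff (Suc n) * (1 - fps_X ^ Suc n) * gauss_prod n)"
    unfolding gauss_prod_Suc_mult by (simp only: mult_ac mult_minus_left mult_minus_right)
  finally show ?case unfolding Suc by simp
qed

text \<open>By the recurrence for \<open>gauss_coeff\<close>, each summand is the difference of the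
  right-hand side at \<open>Suc s\<close> and at \<open>s\<close>; the bracket splits as -(1 - X^s)
  - x(1 + X^s), one piece for each.\<close>

lemma gauss_telescope:
  fixes x :: "real fps"
  assumes "x = fps_X ^ m"
  shows "(\<Sum>s<n. gauss_coeff s * x ^ s * ((1 - x) * fps_X ^ s - (1 + x)))
       = gauss_coeff n * (1 - fps_X ^ n) * x ^ n"
proof (induction n)
  case (Suc n)
  have "(1 - x) * fps_X ^ n - (1 + x) = - (1 - fps_X ^ n) - x * (1 + fps_X ^ n)"
    by (simp add: algebra_simps)
  then have "(\<Sum>s<Suc n. gauss_coeff s * x ^ s * ((1 - x) * fps_X ^ s - (1 + x)))
      = gauss_coeff n * (1 - fps_X ^ n) * x ^ n
        + gauss_coeff n * x ^ n * (- (1 - fps_X ^ n) - x * (1 + fps_X ^ n))"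
    using Suc by simp
  also have "\<dots> = (- gauss_coeff n * (1 + fps_X ^ n)) * x ^ Suc n"
    by (simp add: algebra_simps)
  finally show ?case by (simp only: gauss_coeff_Suc_mult)
qed simp

lemma gauss_finite_identity:
  "gauss_prod n * (\<Sum>s\<le>n. gauss_coeff s * fps_X ^ (s * Suc n))
     = 1 + 2 * (\<Sum>k = 1..n. (-1) ^ k * fps_X ^ k\<^sup>2)"
proof (induction n)
  case (Suc n)
  define x :: "real fps" where "x = fps_X ^ Suc n"
  define U where "U = (\<Sum>s\<le>n. gauss_coeff s * fps_X ^ (s * Suc n))"
  define V where "V = (\<Sum>s\<le>Suc n. gauss_coeff s * fps_X ^ (s * Suc (Suc n)))"
  define c where "c = gauss_coeff (Suc n)"
  define P where "P = gauss_prod n"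
  define P' where "P' = gauss_prod (Suc n)"
  have PP': "P' * (1 + x) = P * (1 - x)"
    unfolding P_def P'_def x_def by (rule gauss_prod_Suc_mult)
  have cP: "c * (1 - x) * P = 2 * (-1) ^ Suc n"
    unfolding P_def c_def x_def by (rule gauss_coeff_mult_gauss_prod)
  have xs: "x ^ s = fps_X ^ (s * Suc n)" for s
    by (simp only: x_def power_mult [symmetric] mult.commute)
  have U: "U = (\<Sum>s<Suc n. gauss_coeff s * x ^ s)"
    by (simp only: U_def xs lessThan_Suc_atMost)
  have V: "V = (\<Sum>s<Suc n. gauss_coeff s * x ^ s * fps_X ^ s) + c * x ^ Suc n * x"
  proof -
    have "fps_X ^ (s * Suc (Suc n)) = x ^ s * (fps_X ^ s :: real fps)" for s
      by (simp add: xs power_add mult_ac)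
    then show ?thesis
      unfolding V_def c_def
      by (simp only: lessThan_Suc_atMost sum.atMost_Suc mult.assoc x_def [symmetric])
  qed
  \<comment> \<open>The weights come from \<open>PP'\<close>: comparing \<open>P' * V\<close> with
    \<open>P * U\<close> amounts to comparing (1 - x)V with (1 + x)U. The terms s \<le> n telescope;
    the top term of \<open>V\<close> remains.\<close>
  have "(1 - x) * V - (1 + x) * U
      = (\<Sum>s<Suc n. gauss_coeff s * x ^ s * ((1 - x) * fps_X ^ s - (1 + x)))
        + (1 - x) * (c * x ^ Suc n * x)"
    unfolding U V distrib_left sum_distrib_left
    by (simp add: sum_subtractf [symmetric] algebra_simps del: sum.lessThan_Suc power_Suc)
  also have "\<dots> = c * (1 - x) * x ^ Suc n * (1 + x)"
    unfolding gauss_telescope[OF x_def] c_def [symmetric] x_def [symmetric]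
    by (simp add: algebra_simps)
  finally have VU: "(1 - x) * V = (1 + x) * U + c * (1 - x) * x ^ Suc n * (1 + x)"
    by (simp add: algebra_simps)
  have "(1 + x) * (P' * V) = (P' * (1 + x)) * V"
    by (simp only: mult_ac)
  also have "\<dots> = P * ((1 - x) * V)"
    unfolding PP' by (simp only: mult_ac)
  also have "\<dots> = (1 + x) * (P * U + (c * (1 - x) * P) * x ^ Suc n)"
    unfolding VU by (simp only: algebra_simps)
  finally have "(1 + x) * (P' * V) = (1 + x) * (P * U + (c * (1 - x) * P) * x ^ Suc n)" .
  moreover have "1 + x \<noteq> 0"
  proof
    assume "1 + x = 0"
    then have "(1 + x) $ 0 = 0" by simp
    then show False by (simp add: x_def)
  qed
  ultimately have "P' * V = P * U + (c * (1 - x) * P) * x ^ Suc n"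
    by simp
  also have "P * U = 1 + 2 * (\<Sum>k = 1..n. (-1) ^ k * fps_X ^ k\<^sup>2)"
    using Suc by (simp only: P_def U_def)
  \<comment> \<open>The boundary term of the telescoping is exactly the new theta term k = n +
    1.\<close>
  also have "c * (1 - x) * P * x ^ Suc n = 2 * ((-1) ^ Suc n * fps_X ^ (Suc n)\<^sup>2)"
    unfolding cP xs by (simp only: mult.assoc power2_eq_square)
  finally show ?case
    unfolding P'_def V_def by (simp add: algebra_simps)
qed simp

section \<open>Powers of the theta series\<close>

text \<open>The sign (-1)^k of the term q^(k^2) is written as (-1)^n with n = k^2, which has the
  parity of k; a sign depending only on the degree passes unchanged to all powers.\<close>

definition theta_fps :: "real fps" where
  "theta_fps = Abs_fps (\<lambda>n. (-1) ^ n * real (card {x :: int. x\<^sup>2 = int n}))"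

lemma finite_int_square_eq: "finite {x :: int. x\<^sup>2 = int n}"
proof -
  have "(\<lambda>x :: int. [x]) ` {x. x\<^sup>2 = int n}
      \<subseteq> {xs :: int list. length xs = 1 \<and> (\<Sum>x\<leftarrow>xs. x\<^sup>2) = int n}" by auto
  then have "finite ((\<lambda>x :: int. [x]) ` {x. x\<^sup>2 = int n})"
    using finite_reps_squares by (rule finite_subset)
  then show ?thesis by (rule finite_imageD) (simp add: inj_on_def)
qed

lemma num_reps_squares_0: "num_reps_squares 0 n = (if n = 0 then 1 else 0)"
proof -
  have "{xs :: int list. length xs = 0 \<and> (\<Sum>x\<leftarrow>xs. x\<^sup>2) = int n} = (if n = 0 then {[]} else {})"
    by auto
  then show ?thesis unfolding num_reps_squares_def by simp
qed

text \<open>Representations are sorted by the square \<open>i\<close> of their first entry, giving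
  the convolution that matches the Cauchy product in \<open>theta_fps ^ Suc r\<close>.\<close>

lemma num_reps_squares_Suc:
  "num_reps_squares (Suc r) n
     = (\<Sum>i\<le>n. card {x :: int. x\<^sup>2 = int i} * num_reps_squares r (n - i))"
proof -
  let ?R = "\<lambda>r n. {xs :: int list. length xs = r \<and> (\<Sum>x\<leftarrow>xs. x\<^sup>2) = int n}"
  let ?S = "\<lambda>i. {x :: int. x\<^sup>2 = int i}"
  let ?C = "\<lambda>i. (\<lambda>(x, xs). x # xs) ` (?S i \<times> ?R r (n - i))"
  have "?R (Suc r) n = (\<Union>i\<in>{..n}. ?C i)"
  proof (intro equalityI subsetI)
    fix ys assume ys: "ys \<in> ?R (Suc r) n"
    then obtain x xs where yx: "ys = x # xs" "length xs = r"
      by (auto simp: length_Suc_conv)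
    have "(\<Sum>x\<leftarrow>xs. x\<^sup>2) \<ge> 0" by (rule sum_list_nonneg) auto
    then have "x\<^sup>2 = int (nat (x\<^sup>2))" "nat (x\<^sup>2) \<le> n" "(\<Sum>x\<leftarrow>xs. x\<^sup>2) = int (n - nat (x\<^sup>2))"
      using ys yx by auto
    then show "ys \<in> (\<Union>i\<in>{..n}. ?C i)" using yx by blast
  qed auto
  then have "num_reps_squares (Suc r) n = card (\<Union>i\<in>{..n}. ?C i)"
    by (simp add: num_reps_squares_def)
  also have "\<dots> = (\<Sum>i\<le>n. card (?C i))"
  proof (rule card_UN_disjoint)
    show "\<forall>i\<in>{..n}. finite (?C i)"
      by (intro ballI finite_imageI finite_cartesian_product finite_int_square_eq
          finite_reps_squares)
  qed auto
  also have "\<dots> = (\<Sum>i\<le>n. card (?S i) * num_reps_squares r (n - i))"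
    unfolding num_reps_squares_def
    by (intro sum.cong refl, subst card_image)
      (auto simp: inj_on_def card_cartesian_product)
  finally show ?thesis .
qed

lemma theta_fps_power_nth: "(theta_fps ^ r) $ n = (-1) ^ n * real (num_reps_squares r n)"
proof (induction r arbitrary: n)
  case 0
  show ?case by (simp add: num_reps_squares_0)
next
  case (Suc r)
  have "(theta_fps ^ Suc r) $ n = (\<Sum>i\<le>n. theta_fps $ i * (theta_fps ^ r) $ (n - i))"
    by (simp add: fps_mult_nth atLeast0AtMost)
  also have "\<dots> = (\<Sum>i\<le>n. (-1) ^ n * real (card {x :: int. x\<^sup>2 = int i}
      * num_reps_squares r (n - i)))"
  proof (rule sum.cong)
    fix i assume "i \<in> {..n}"
    then have "(-1 :: real) ^ n = (-1) ^ i * (-1) ^ (n - i)"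
      by (simp flip: power_add)
    then show "theta_fps $ i * (theta_fps ^ r) $ (n - i)
        = (-1) ^ n * real (card {x :: int. x\<^sup>2 = int i} * num_reps_squares r (n - i))"
      unfolding Suc by (simp add: theta_fps_def)
  qed simp
  finally show ?case by (simp add: num_reps_squares_Suc sum_distrib_left)
qed

lemma theta_fps_nth_0: "theta_fps $ 0 = 1"
  by (simp add: theta_fps_def)

section \<open>Truncating the theta series and comparing it with the product\<close>

lemma sum_symmetric_int_interval:
  fixes f :: "int \<Rightarrow> 'a :: comm_ring_1"
  assumes "\<And>x. f (- x) = f x"
  shows "(\<Sum>x\<in>{- int n..int n}. f x) = f 0 + 2 * (\<Sum>k = 1..n. f (int k))"
proof (induction n)
  case (Suc n)
  have "{- int (Suc n)..int (Suc n)}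
      = insert (int (Suc n)) (insert (- int (Suc n)) {- int n..int n})" by auto
  then have "(\<Sum>x\<in>{- int (Suc n)..int (Suc n)}. f x)
      = f (int (Suc n)) + (f (- int (Suc n)) + (\<Sum>x\<in>{- int n..int n}. f x))"
    by simp
  also have "f (- int (Suc n)) = f (int (Suc n))" by (rule assms)
  finally show ?case by (simp add: Suc algebra_simps del: of_nat_Suc)
qed simp

text \<open>Since |x| \<le> x^2, every integer with square i \<le> n lies in [-n, n], so the
  symmetric partial sum already contains all terms of degree i.\<close>

lemma theta_fps_nth_partial_sum:
  assumes "i \<le> n"
  shows "theta_fps $ i = (1 + 2 * (\<Sum>k = 1..n. (-1) ^ k * fps_X ^ k\<^sup>2)) $ i"
proof -
  define f :: "int \<Rightarrow> real fps" where "f x = (-1) ^ nat \<bar>x\<bar> * fps_X ^ (nat \<bar>x\<bar>)\<^sup>2" for x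
  have sq: "x\<^sup>2 = int i \<longleftrightarrow> i = (nat \<bar>x\<bar>)\<^sup>2" for x :: int
  proof -
    have "x\<^sup>2 = int ((nat \<bar>x\<bar>)\<^sup>2)" by simp
    then show ?thesis by linarith
  qed
  have f_nth: "f x $ i = (if x\<^sup>2 = int i then (-1) ^ i else 0)" for x
  proof -
    have "f x = fps_const ((-1) ^ nat \<bar>x\<bar>) * fps_X ^ (nat \<bar>x\<bar>)\<^sup>2"
      by (simp add: f_def flip: fps_const_power fps_const_neg)
    then have "f x $ i = (if i = (nat \<bar>x\<bar>)\<^sup>2 then (-1) ^ nat \<bar>x\<bar> else 0)"
      by (simp add: fps_X_power_nth)
    moreover have "(-1 :: real) ^ nat \<bar>x\<bar> = (-1) ^ ((nat \<bar>x\<bar>)\<^sup>2)"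
      by (cases "even (nat \<bar>x\<bar>)") auto
    ultimately show ?thesis by (simp add: sq)
  qed
  have "{x :: int. x\<^sup>2 = int i} \<subseteq> {- int n..int n}"
  proof
    fix x :: int assume "x \<in> {x. x\<^sup>2 = int i}"
    then have "i = (nat \<bar>x\<bar>)\<^sup>2" by (simp add: sq)
    then have "nat \<bar>x\<bar> \<le> i" by (simp add: power2_nat_le_imp_le)
    with assms show "x \<in> {- int n..int n}" by auto
  qed
  then have int: "{- int n..int n} \<inter> {x. x\<^sup>2 = int i} = {x. x\<^sup>2 = int i}" by blast
  have "(\<Sum>x\<in>{- int n..int n}. f x) $ i = (\<Sum>x\<in>{- int n..int n}. if x\<^sup>2 = int i then (-1) ^ i else 0)"
    by (simp add: fps_sum_nth f_nth)
  also have "\<dots> = theta_fps $ i"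
    by (simp add: sum.If_cases int theta_fps_def)
  also have "(\<Sum>x\<in>{- int n..int n}. f x) = 1 + 2 * (\<Sum>k = 1..n. (-1) ^ k * fps_X ^ k\<^sup>2)"
    by (subst sum_symmetric_int_interval) (simp_all add: f_def)
  finally show ?thesis by simp
qed

lemma fps_X_power_dvd_iff:
  fixes f :: "'a :: field fps"
  shows "fps_X ^ N dvd f \<longleftrightarrow> (\<forall>i<N. f $ i = 0)"
proof (cases "f = 0")
  case False
  have "fps_X ^ N dvd f \<longleftrightarrow> N \<le> subdegree f"
    using False by (simp add: fps_dvd_iff fps_X_power_subdegree)
  also have "\<dots> \<longleftrightarrow> (\<forall>i<N. f $ i = 0)"
    using False subdegree_geI less_le_trans nth_less_subdegree_zero by metis
  finally show ?thesis .
qed simp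

text \<open>Both series are compared with the partial theta sum \<open>?A\<close>. In the finite
  identity every term with s \<ge> 1 carries X^(s(n+1)), so modulo X^(n+1) only the term s = 0, the
  product itself, survives.\<close>

lemma theta_fps_cong_gauss_prod: "fps_X ^ Suc n dvd theta_fps - gauss_prod n"
proof -
  let ?A = "1 + 2 * (\<Sum>k = 1..n. (-1) ^ k * fps_X ^ k\<^sup>2) :: real fps"
  have "fps_X ^ Suc n dvd theta_fps - ?A"
    unfolding fps_X_power_dvd_iff using theta_fps_nth_partial_sum by (simp del: fps_add_nth)
  moreover have "fps_X ^ Suc n dvd ?A - gauss_prod n"
  proof -
    have "(\<Sum>s\<le>n. gauss_coeff s * fps_X ^ (s * Suc n))
        = 1 + (\<Sum>s = 1..n. gauss_coeff s * fps_X ^ (s * Suc n))"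
      by (simp add: atMost_atLeast0 sum.atLeast_Suc_atMost)
    then have "?A - gauss_prod n = gauss_prod n * (\<Sum>s = 1..n. gauss_coeff s * fps_X ^ (s * Suc n))"
      unfolding gauss_finite_identity [symmetric] by (simp add: algebra_simps)
    moreover have "fps_X ^ Suc n dvd (\<Sum>s = 1..n. gauss_coeff s * fps_X ^ (s * Suc n) :: real fps)"
    proof (intro dvd_sum dvd_mult le_imp_power_dvd)
      fix s assume "s \<in> {1..n}"
      then show "Suc n \<le> s * Suc n" using mult_le_mono1[of 1 s "Suc n"] by simp
    qed
    ultimately show ?thesis by simp
  qed
  ultimately have "fps_X ^ Suc n dvd (theta_fps - ?A) + (?A - gauss_prod n)"
    by (rule dvd_add)
  then show ?thesis by simp
qed

section \<open>Logarithmic derivatives\<close>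

text \<open>\<open>odd_multiples_fps j\<close> is the expansion of \<open>q\<^sup>j / (1 - q\<^bsup>2j\<^esup>)\<close>.\<close>

definition odd_multiples_fps :: "nat \<Rightarrow> real fps" where
  "odd_multiples_fps j = Abs_fps (\<lambda>k. if j dvd k \<and> odd (k div j) then 1 else 0)"

text \<open>A shift by 2j permutes neither parity nor divisibility of multiples of \<open>j\<close>,
  so all coefficients cancel except the lowest, at k = j.\<close>

lemma odd_multiples_fps_mult:
  assumes "j > 0"
  shows "(1 - (fps_X ^ j)\<^sup>2) * odd_multiples_fps j = fps_X ^ j"
proof (rule fps_ext)
  fix k
  have sq: "((fps_X :: real fps) ^ j)\<^sup>2 = fps_X ^ (2 * j)"
    by (simp add: mult.commute flip: power_mult)
  have lhs: "((1 - (fps_X ^ j)\<^sup>2) * odd_multiples_fps j) $ k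
      = odd_multiples_fps j $ k - (if k < 2 * j then 0 else odd_multiples_fps j $ (k - 2 * j))"
    by (simp add: sq left_diff_distrib fps_X_power_mult_nth)
  show "((1 - (fps_X ^ j)\<^sup>2) * odd_multiples_fps j) $ k = fps_X ^ j $ k"
  proof (cases "k < 2 * j")
    case True
    have "j dvd k \<and> odd (k div j) \<longleftrightarrow> k = j"
    proof
      assume a: "j dvd k \<and> odd (k div j)"
      then obtain m where m: "k = j * m" by blast
      with True assms have "m < 2" by simp
      moreover have "odd m" using a m assms by simp
      ultimately have "m = 1" by (cases m) auto
      then show "k = j" using m by simp
    qed (use assms in auto)
    then show ?thesis
      unfolding lhs using True by (simp add: odd_multiples_fps_def fps_X_power_nth)
  next
    case False
    then obtain l where l: "k = l + 2 * j"
      by (metis add.commute le_Suc_ex not_less)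
    have "j dvd k \<longleftrightarrow> j dvd l" by (simp add: l)
    moreover have "k div j = l div j + 2" using assms by (simp add: l)
    ultimately show ?thesis
      unfolding lhs using assms by (simp add: odd_multiples_fps_def fps_X_power_nth l)
  qed
qed

lemma X_mult_deriv_X_power:
  "fps_X * fps_deriv (fps_X ^ j) = (of_nat j * fps_X ^ j :: 'a :: comm_ring_1 fps)"
proof (cases j)
  case (Suc k)
  have "fps_deriv (fps_X ^ j) = (of_nat j * fps_X ^ k :: 'a fps)"
    unfolding fps_deriv_power Suc by (simp add: fps_of_nat del: of_nat_Suc)
  then show ?thesis by (simp add: Suc mult_ac del: of_nat_Suc)
qed simp

text \<open>With x = q^j, applying q d/dq to log((1 - x)/(1 + x)) gives -jx/(1 - x) - jx/(1 + x) =
  -2jx/(1 - x^2); the factors add up.\<close>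

lemma gauss_prod_log_deriv:
  "fps_X * fps_deriv (gauss_prod n)
     = - 2 * gauss_prod n * (\<Sum>j = 1..n. of_nat j * odd_multiples_fps j)"
proof (induction n)
  case (Suc n)
  define j where "j = Suc n"
  define x :: "real fps" where "x = fps_X ^ j"
  define L where "L = (\<Sum>j = 1..n. of_nat j * odd_multiples_fps j)"
  define P where "P = gauss_prod n"
  define P' where "P' = gauss_prod (Suc n)"
  define D where "D = fps_X * fps_deriv P"
  define D' where "D' = fps_X * fps_deriv P'"
  define E where "E = odd_multiples_fps j"
  define J :: "real fps" where "J = of_nat j"
  have D: "D = - 2 * P * L"
    using Suc by (simp add: D_def P_def L_def)
  have E: "(1 - x\<^sup>2) * E = x"
    unfolding x_def E_def by (rule odd_multiples_fps_mult) (simp add: j_def)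
  have PP': "P' * (1 + x) = P * (1 - x)"
    unfolding P_def P'_def x_def j_def by (rule gauss_prod_Suc_mult)
  have dx: "fps_X * fps_deriv x = J * x"
    unfolding x_def J_def by (rule X_mult_deriv_X_power)
  have "fps_X * fps_deriv (P' * (1 + x)) = D' * (1 + x) + P' * (fps_X * fps_deriv x)"
    by (simp add: D'_def algebra_simps)
  moreover have "fps_X * fps_deriv (P * (1 - x)) = D * (1 - x) - P * (fps_X * fps_deriv x)"
    by (simp add: D_def algebra_simps)
  ultimately have "D' * (1 + x) + P' * (J * x) = D * (1 - x) - P * (J * x)"
    using PP' dx by simp
  \<comment> \<open>Multiply by 1 - x, replace P(1 - x) by P'(1 + x), and write x as (1 -
    x^2)E.\<close>
  then have "(1 - x\<^sup>2) * D' = (1 - x\<^sup>2) * (- 2 * P' * (L + J * E))"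
    using PP' E D by algebra
  moreover have "1 - x\<^sup>2 \<noteq> 0"
  proof
    assume "1 - x\<^sup>2 = 0"
    then have "(1 - x\<^sup>2) $ 0 = 0" by simp
    then show False by (simp add: x_def j_def power2_eq_square)
  qed
  ultimately have "D' = - 2 * P' * (L + J * E)"
    using mult_left_cancel by blast
  then show ?case
    by (simp add: D'_def P'_def L_def J_def E_def j_def del: gauss_prod.simps of_nat_Suc)
qed simp

text \<open>The involution j \<mapsto> n/j on divisors turns the condition that n/j is odd into an
  odd divisor d, with j = n/d.\<close>

lemma sum_odd_multiples_fps_nth:
  assumes "n > 0"
  shows "(\<Sum>j = 1..n. of_nat j * odd_multiples_fps j) $ n
       = real n * (\<Sum>d\<in>{d. d dvd n \<and> odd d}. 1 / real d)"
proof -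
  have "(\<Sum>j = 1..n. of_nat j * odd_multiples_fps j) $ n
      = (\<Sum>j = 1..n. if j dvd n \<and> odd (n div j) then real j else 0)"
    by (simp add: fps_sum_nth odd_multiples_fps_def flip: fps_of_nat)
      (intro sum.cong, auto)
  also have "\<dots> = (\<Sum>j\<in>{j. j dvd n \<and> odd (n div j)}. real j)"
  proof (subst sum.inter_filter [symmetric])
    have "{x \<in> {1..n}. x dvd n \<and> odd (n div x)} = {j. j dvd n \<and> odd (n div j)}"
      using assms dvd_imp_le[of _ n] dvd_pos_nat[of n] by (auto simp: Suc_le_eq)
    then show "(\<Sum>x\<in>{x \<in> {1..n}. x dvd n \<and> odd (n div x)}. real x)
        = (\<Sum>j\<in>{j. j dvd n \<and> odd (n div j)}. real j)" by simp
  qed simp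
  also have "\<dots> = (\<Sum>d\<in>{d. d dvd n \<and> odd d}. real n / real d)"
    using assms
    by (intro sum.reindex_bij_witness[where i = "\<lambda>d. n div d" and j = "\<lambda>d. n div d"])
      (auto simp: real_of_nat_div)
  also have "\<dots> = real n * (\<Sum>d\<in>{d. d dvd n \<and> odd d}. 1 / real d)"
    by (simp add: sum_distrib_left)
  finally show ?thesis .
qed

section \<open>The truncated logarithm series\<close>

definition log_partial_sum :: "nat \<Rightarrow> real fps \<Rightarrow> real fps" where
  "log_partial_sum N t = (\<Sum>m = 1..N. fps_const ((-1) ^ Suc m / real m) * (t - 1) ^ m)"

text \<open>The derivative is t' times the geometric sum of (1 - t)^m over m < N, and multiplying by
  t = 1 - (1 - t) telescopes it.\<close>

lemma log_partial_sum_deriv: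
  "t * fps_deriv (log_partial_sum N t) = fps_deriv t * (1 - (1 - t) ^ N)"
proof (induction N)
  case (Suc N)
  have "fps_deriv (fps_const ((-1) ^ Suc (Suc N) / real (Suc N)) * (t - 1) ^ Suc N)
      = fps_const ((-1) ^ N) * (fps_deriv t * (t - 1) ^ N)"
    by (simp add: fps_deriv_power mult.assoc [symmetric] del: of_nat_Suc power_Suc)
      (simp add: fps_deriv_power mult_ac)
  also have "\<dots> = fps_deriv t * (1 - t) ^ N"
  proof -
    have "(1 - t) ^ N = (-1) ^ N * (t - 1) ^ N"
      by (simp flip: power_mult_distrib)
    then show ?thesis by (simp add: mult_ac flip: fps_const_power fps_const_neg)
  qed
  finally have "fps_deriv (log_partial_sum (Suc N) t)
      = fps_deriv (log_partial_sum N t) + fps_deriv t * (1 - t) ^ N"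
    unfolding log_partial_sum_def by (simp del: power_Suc of_nat_Suc fps_deriv_mult)
  then have "t * fps_deriv (log_partial_sum (Suc N) t)
      = fps_deriv t * (1 - (1 - t) ^ N) + t * (fps_deriv t * (1 - t) ^ N)"
    using Suc by (simp add: distrib_left)
  also have "\<dots> = fps_deriv t * (1 - (1 - t) ^ Suc N)"
    by (simp add: algebra_simps)
  finally show ?case .
qed (simp add: log_partial_sum_def)

text \<open>Absorption, C(m,r)/m = C(m-1,r-1)/r, reduces the sum to repeated use of Pascal's
  rule.\<close>

lemma sum_choose_div:
  assumes "r > 0"
  shows "(\<Sum>m = 1..n. real (m choose r) / real m) = real (n choose r) / real r"
proof (induction n)
  case (Suc n)
  obtain k where k: "r = Suc k" using assms by (cases r) auto
  have "Suc k * (Suc n choose Suc k) = Suc n * (n choose k)"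
    by (rule Suc_times_binomial)
  then have "real (Suc k) * real (Suc n choose Suc k) = real (Suc n) * real (n choose k)"
    by (metis of_nat_mult)
  then have "real (Suc n choose r) / real (Suc n) = real (n choose k) / real r"
    unfolding k by (simp add: field_simps del: binomial_Suc_Suc of_nat_Suc)
  then have "(\<Sum>m = 1..Suc n. real (m choose r) / real m)
      = real (n choose r) / real r + real (n choose k) / real r"
    using Suc by simp
  then show ?case by (simp add: k add_divide_distrib)
qed (use assms in simp)

lemma log_partial_sum_theta_nth:
  assumes "n > 0"
  shows "log_partial_sum n theta_fps $ n
       = - (\<Sum>r = 1..n. (-1) ^ (n + r) / real r * real (n choose r) * real (num_reps_squares r n))"
proof -
  let ?c = "\<lambda>r. (-1) ^ n * real (num_reps_squares r n)"
  \<comment> \<open>The range of \<open>r\<close> is made independent of \<open>m\<close>, so that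
    the two sums can be interchanged.\<close>
  have pow: "((theta_fps - 1) ^ m) $ n = (\<Sum>r = 1..n. real (m choose r) * (-1) ^ (m + r) * ?c r)"
    if "m \<in> {1..n}" for m
  proof -
    have "(theta_fps - 1) ^ m
        = (\<Sum>r\<le>m. of_nat (m choose r) * theta_fps ^ r * (-1) ^ (m - r))"
      using binomial_ring[of theta_fps "-1" m] by simp
    also have "\<dots> = (\<Sum>r\<le>m. fps_const (real (m choose r) * (-1) ^ (m + r)) * theta_fps ^ r)"
    proof (rule sum.cong)
      fix r assume "r \<in> {..m}"
      then have sign: "(-1 :: real) ^ (m + r) = (-1) ^ (m - r)"
        by (simp add: minus_one_power_iff)
      have "fps_const (real (m choose r) * (-1) ^ (m + r))
          = of_nat (m choose r) * (-1 :: real fps) ^ (m - r)"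
        unfolding sign by (simp add: fps_of_nat flip: fps_const_mult fps_const_power fps_const_neg)
      then show "of_nat (m choose r) * theta_fps ^ r * (-1) ^ (m - r)
          = fps_const (real (m choose r) * (-1) ^ (m + r)) * theta_fps ^ r"
        by (simp only: mult_ac)
    qed simp
    finally have "((theta_fps - 1) ^ m) $ n
        = (\<Sum>r\<le>m. real (m choose r) * (-1) ^ (m + r) * ?c r)"
      by (simp add: fps_sum_nth theta_fps_power_nth)
    \<comment> \<open>Terms with r > m have a zero binomial; r = 0 drops out because n > 0 is not an
      empty sum of squares.\<close>
    also have "\<dots> = (\<Sum>r = 1..n. real (m choose r) * (-1) ^ (m + r) * ?c r)"
    proof (rule sum.mono_neutral_cong)
      fix r assume "r \<in> {..m} - {1..n}"
      then have "r = 0" using that by auto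
      then show "real (m choose r) * (-1) ^ (m + r) * ?c r = 0"
        using assms by (simp add: num_reps_squares_0)
    qed (use that in auto)
    finally show ?thesis .
  qed
  have "log_partial_sum n theta_fps $ n
      = (\<Sum>m = 1..n. (-1) ^ Suc m / real m * (\<Sum>r = 1..n. real (m choose r) * (-1) ^ (m + r) * ?c r))"
    unfolding log_partial_sum_def fps_sum_nth fps_mult_left_const_nth
    by (intro sum.cong refl) (simp only: pow)
  also have "\<dots> = (\<Sum>m = 1..n. \<Sum>r = 1..n. - ((-1) ^ r * ?c r) * (real (m choose r) / real m))"
    unfolding sum_distrib_left
    by (intro sum.cong refl) (simp add: power_add)
  also have "\<dots> = (\<Sum>r = 1..n. - ((-1) ^ r * ?c r) * (\<Sum>m = 1..n. real (m choose r) / real m))"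
    unfolding sum_distrib_left by (rule sum.swap)
  also have "\<dots> = (\<Sum>r = 1..n. - ((-1) ^ (n + r) / real r * real (n choose r)
      * real (num_reps_squares r n)))"
    by (intro sum.cong refl, subst sum_choose_div) (auto simp: power_add)
  finally show ?thesis by (simp add: sum_negf)
qed

section \<open>Comparing the two logarithmic derivatives modulo X^(n+1)\<close>

theorem theorem1:
  fixes n :: nat
  assumes "n > 0"
  shows "(\<Sum>d\<in>{d. d dvd n \<and> odd d}. 1 / real d) =
         1 / 2 * (\<Sum>r = 1..n. (-1) ^ (n + r) / real r * real (n choose r) *
                    real (num_reps_squares r n))"
proof -
  let ?q = "fps_X ^ Suc n :: real fps"
  define L where "L = (\<Sum>j = 1..n. of_nat j * odd_multiples_fps j)"
  define G where "G = fps_deriv (log_partial_sum n theta_fps)"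
  define D where "D = theta_fps - gauss_prod n"
  define W where "W = (1 - theta_fps) ^ n"
  have D: "?q dvd D" unfolding D_def by (rule theta_fps_cong_gauss_prod)
  \<comment> \<open>X d/dX multiplies the coefficient of X^i by i, so vanishing coefficients stay
    zero.\<close>
  have D': "?q dvd fps_X * fps_deriv D"
    using D by (simp add: fps_X_power_dvd_iff del: power_Suc)
  \<comment> \<open>The truncation error \<open>W\<close> has order at least n; the factor X in
    front of the derivative supplies the missing power.\<close>
  have "fps_X dvd 1 - theta_fps"
    using fps_X_power_dvd_iff[of 1 "1 - theta_fps"] by (simp add: theta_fps_nth_0)
  then have "fps_X ^ n dvd (1 - theta_fps) ^ n" by (rule dvd_power_same)
  then have W: "?q dvd fps_X * W" by (simp add: W_def mult_dvd_mono)
  \<comment> \<open>Substituting \<open>theta_fps - D\<close> for the product leaves three error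
    terms, each divisible by \<open>?q\<close>.\<close>
  have "theta_fps * (fps_X * G + 2 * L)
      = fps_X * fps_deriv D + 2 * L * D - fps_deriv theta_fps * (fps_X * W)"
  proof -
    have "theta_fps * G = fps_deriv theta_fps * (1 - W)"
      unfolding G_def W_def by (rule log_partial_sum_deriv)
    moreover have "fps_X * fps_deriv (gauss_prod n) = - 2 * gauss_prod n * L"
      unfolding L_def by (rule gauss_prod_log_deriv)
    moreover have "fps_deriv D = fps_deriv theta_fps - fps_deriv (gauss_prod n)"
      by (simp add: D_def)
    ultimately show ?thesis using D_def by algebra
  qed
  also have "?q dvd \<dots>"
    by (intro dvd_diff dvd_add D' dvd_mult D W)
  \<comment> \<open>\<open>theta_fps\<close> has constant term 1, hence is a unit and can be
    removed.\<close>
  finally have "?q dvd inverse theta_fps * (theta_fps * (fps_X * G + 2 * L))"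
    by (rule dvd_mult)
  moreover have "inverse theta_fps * theta_fps = 1"
    by (rule inverse_mult_eq_1) (simp add: theta_fps_nth_0)
  ultimately have "?q dvd fps_X * G + 2 * L"
    by (simp only: mult.assoc [symmetric] mult_1_left)
  then have "(fps_X * G + 2 * L) $ n = 0"
    unfolding fps_X_power_dvd_iff by blast
  then have "real n * log_partial_sum n theta_fps $ n + 2 * L $ n = 0"
    using assms by (simp add: G_def fps_numeral_fps_const)
  then have "real n * (log_partial_sum n theta_fps $ n
      + 2 * (\<Sum>d\<in>{d. d dvd n \<and> odd d}. 1 / real d)) = 0"
    unfolding L_def sum_odd_multiples_fps_nth[OF assms] by (simp add: algebra_simps)
  then show ?thesis
    using assms by (simp add: log_partial_sum_theta_nth)
qed

end
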